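(* Let $Q$ and $GM$ be two geometries with Z-address intervals $Zitvl_Q = [Zmin_Q, Zmax_Q]$ and $Zitvl_{GM} = [Zmin_{GM}, Zmax_{GM}]$. If $Q$ contains $GM$, then $Zitvl_Q$ contains $Zitvl_{GM}$, i.e. $$Zmin_Q \le Zmin_{GM} \le Zmax_Q \quad\text{and}\quad Zmin_Q \le Zmax_{GM} \le Zmax_Q .$$
   Context: A geometry is a nonempty closed bounded planar set of points (longitude, latitude) in $[-180,180]\times[-90,90]$ (a point, line string, polygon, or finite collection of these). The interior of a geometry is meant in the usual GIS (SQL/MM) sense: for a polygon its topological interior, for a line string the curve without its endpoints (the whole curve if it is closed), for a point the point itself; the exterior of a geometry is its complement in the plane. Contains: "$Q$ contains $GM$" holds if and only if no point of $GM$ lies in the exterior of $Q$, and at least one point of the interior of $GM$ lies in the interior of $Q$. Minimum bounding rectangle (MBR): the MBR of a geometry is given by the two points $p_{min}=(x_{min},y_{min})$ and $p_{max}=(x_{max},y_{max})$, where $x_{min},x_{max},y_{min},y_{max}$ are the minimum and maximum values of the first and second coordinates over the geometry. Z-address: fix a cell size $c>0$ (the same for all geometries; e.g. $c=5\times 10^{-7}$). A point (longitude, latitude) is mapped to the non-negative integer coordinates $x=\lfloor(\text{longitude}+180)/c\rfloor$, $y=\lfloor(\text{latitude}+90)/c\rfloor$. Its Z-address is the non-negative integer obtained by interleaving the binary digits of $x$ and $y$: if $x=\sum_i x_i2^i$ and $y=\sum_i y_i2^i$ with $x_i,y_i\in\{0,1\}$, the Z-address is $\sum_i (x_i 2^{2i}+y_i2^{2i+1})$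 (for example, the integer coordinates $(0,1)$ have Z-address $2$). Z-address interval: for a geometry $G$ with MBR points $p_{min}$ and $p_{max}$, $Zmin_G$ is the Z-address of $p_{min}$, $Zmax_G$ is the Z-address of $p_{max}$, and $Zitvl_G=[Zmin_G,Zmax_G]$ (an interval of integers). *)

theory Defs
  imports "HOL-Analysis.Analysis"
begin

type_synonym plane_point = "real \<times> real"  \<comment> \<open>(longitude, latitude)\<close>

datatype primitive =
    Point plane_point
  | LineString "plane_point list"
  | Polygon "plane_point list" "plane_point list list"  \<comment> \<open>exterior ring, list of holes\<close>

text \<open>A single point, line string or polygon is represented by a one-element list;
  longer lists are (possibly heterogeneous) collections.\<close>

type_synonym geometry = "primitive list"

text \<open>The equation for the empty list is a dummy; valid geometries never use it.\<close>

fun polyline :: "plane_point list \<Rightarrow> real \<Rightarrow> plane_point" where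
  "polyline [] = linepath 0 0"
| "polyline [a] = linepath a a"
| "polyline [a, b] = linepath a b"
| "polyline (a # b # c # vs) = linepath a b +++ polyline (b # c # vs)"

abbreviation curve :: "plane_point list \<Rightarrow> plane_point set" where
  "curve vs \<equiv> path_image (polyline vs)"

definition linear_ring :: "plane_point list \<Rightarrow> bool" where
  "linear_ring vs \<longleftrightarrow> vs \<noteq> [] \<and> hd vs = last vs \<and> simple_path (polyline vs)"

definition polygon_points :: "plane_point list \<Rightarrow> plane_point list list \<Rightarrow> plane_point set" where
  "polygon_points shell holes =
     (curve shell \<union> inside (curve shell)) - (\<Union>h\<in>set holes. inside (curve h))"

fun primitive_points :: "primitive \<Rightarrow> plane_point set" where
  "primitive_points (Point p) = {p}"
| "primitive_points (LineString vs) = curve vs"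
| "primitive_points (Polygon shell holes) = polygon_points shell holes"

text \<open>The conditions on polygons are the usual Simple Features / SQL/MM validity conditions:
  rings are simple closed curves that meet only in isolated points, holes lie within
  the exterior ring and do not overlap or nest, and the interior is connected.\<close>

fun valid_primitive :: "primitive \<Rightarrow> bool" where
  "valid_primitive (Point p) \<longleftrightarrow> True"
| "valid_primitive (LineString vs) \<longleftrightarrow> 2 \<le> length vs"
| "valid_primitive (Polygon shell holes) \<longleftrightarrow>
     (\<forall>r\<in>set (shell # holes). linear_ring r) \<and>
     (\<forall>h\<in>set holes. curve h \<subseteq> curve shell \<union> inside (curve shell)) \<and>
     sorted_wrt (\<lambda>r s. finite (curve r \<inter> curve s)) (shell # holes) \<and>
     sorted_wrt (\<lambda>r s. inside (curve r) \<inter> inside (curve s) = {}) holes \<and>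
     connected (interior (polygon_points shell holes))"

definition geom_points :: "geometry \<Rightarrow> plane_point set" where
  "geom_points G = (\<Union>g\<in>set G. primitive_points g)"

definition valid_geometry :: "geometry \<Rightarrow> bool" where
  "valid_geometry G \<longleftrightarrow>
     geom_points G \<noteq> {} \<and> (\<forall>g\<in>set G. valid_primitive g) \<and> geom_points G \<subseteq> {-180..180} \<times> {-90..90}"

text \<open>How often a point occurs as an end of a line string of the geometry.  A closed
  line string counts twice at its common start and end point.\<close>

fun ends_at :: "plane_point \<Rightarrow> primitive \<Rightarrow> nat" where
  "ends_at p (LineString vs) = of_bool (p = hd vs) + of_bool (p = last vs)"
| "ends_at p _ = 0"

definition end_count :: "geometry \<Rightarrow> plane_point \<Rightarrow> nat" where
  "end_count G p = (\<Sum>g\<leftarrow>G. ends_at p g)"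

text \<open>The interior in the SQL/MM sense.  Among the line strings of a collection the mod-2
  rule determines the boundary: a point is a boundary point iff it occurs an odd number of
  times as an end.  For a single line string this removes both end points of an open curve
  and none of a closed curve.  Points, line strings and polygons contribute independently.\<close>

definition geom_interior :: "geometry \<Rightarrow> plane_point set" where
  "geom_interior G =
     {p. Point p \<in> set G} \<union>
     ((\<Union>vs\<in>{vs. LineString vs \<in> set G}. curve vs) - {p. odd (end_count G p)}) \<union>
     (\<Union>(shell, holes)\<in>{(s, hs). Polygon s hs \<in> set G}. interior (polygon_points shell holes))"

definition geom_exterior :: "geometry \<Rightarrow> plane_point set" where
  "geom_exterior G = - geom_points G"

definition contains :: "geometry \<Rightarrow> geometry \<Rightarrow> bool" where
  "contains Q GM \<longleftrightarrow>
     (\<forall>p\<in>geom_points GM. p \<notin> geom_exterior Q) \<and>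
     (\<exists>p\<in>geom_interior GM. p \<in> geom_interior Q)"

text \<open>The infima and suprema are attained, because the point set of a valid geometry is
  compact and nonempty; see the lemmas below.\<close>

definition mbr_min :: "geometry \<Rightarrow> plane_point" where
  "mbr_min G = (Inf (fst ` geom_points G), Inf (snd ` geom_points G))"

definition mbr_max :: "geometry \<Rightarrow> plane_point" where
  "mbr_max G = (Sup (fst ` geom_points G), Sup (snd ` geom_points G))"

definition grid_coords :: "real \<Rightarrow> plane_point \<Rightarrow> nat \<times> nat" where
  "grid_coords c p = (nat \<lfloor>(fst p + 180) / c\<rfloor>, nat \<lfloor>(snd p + 90) / c\<rfloor>)"

definition interleave :: "nat \<times> nat \<Rightarrow> nat" where
  "interleave = (\<lambda>(x, y). (\<Sum>i | bit x i. 2 ^ (2 * i)) + (\<Sum>i | bit y i. 2 ^ (2 * i + 1)))"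

definition z_address :: "real \<Rightarrow> plane_point \<Rightarrow> nat" where
  "z_address c p = interleave (grid_coords c p)"

definition Zmin :: "real \<Rightarrow> geometry \<Rightarrow> nat" where
  "Zmin c G = z_address c (mbr_min G)"

definition Zmax :: "real \<Rightarrow> geometry \<Rightarrow> nat" where
  "Zmax c G = z_address c (mbr_max G)"

definition Zitvl :: "real \<Rightarrow> geometry \<Rightarrow> nat set" where
  "Zitvl c G = {Zmin c G..Zmax c G}"

lemma geom_interior_Point: "geom_interior [Point p] = {p}"
  by (auto simp: geom_interior_def)

lemma geom_interior_LineString:
  "geom_interior [LineString vs] =
     (if hd vs = last vs then curve vs else curve vs - {hd vs, last vs})"
  by (auto simp: geom_interior_def end_count_def)

lemma geom_interior_Polygon:
  "geom_interior [Polygon shell holes] = interior (geom_points [Polygon shell holes])"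
  by (auto simp: geom_interior_def geom_points_def)

lemma path_polyline: "path (polyline vs)"
  and pathstart_polyline: "vs \<noteq> [] \<Longrightarrow> pathstart (polyline vs) = hd vs"
  and pathfinish_polyline: "vs \<noteq> [] \<Longrightarrow> pathfinish (polyline vs) = last vs"
  by (induction vs rule: polyline.induct) auto

lemma compact_polygon_points: "compact (polygon_points shell holes)"
proof -
  have c: "compact (curve vs)" for vs
    by (simp add: compact_path_image path_polyline)
  have o: "open (inside (curve vs))" for vs
    by (simp add: open_inside compact_imp_closed c)
  have "compact (curve shell \<union> inside (curve shell))"
    by (simp add: compact_eq_bounded_closed bounded_inside bounded_path_image
        closed_path_image_Un_inside path_polyline)
  then show ?thesis
    unfolding polygon_points_def by (intro compact_diff open_UN ballI o)
qed

lemma compact_geom_points: "compact (geom_points G)"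
proof -
  have "compact (primitive_points g)" for g
    by (cases g) (auto simp: compact_polygon_points compact_path_image path_polyline)
  then show ?thesis
    by (auto simp: geom_points_def intro!: compact_UN)
qed

lemma
  assumes "geom_points G \<noteq> {}"
  shows mbr_min_attained:
      "fst (mbr_min G) \<in> fst ` geom_points G" "snd (mbr_min G) \<in> snd ` geom_points G"
    and mbr_max_attained:
      "fst (mbr_max G) \<in> fst ` geom_points G" "snd (mbr_max G) \<in> snd ` geom_points G"
proof -
  have c: "compact (fst ` geom_points G)" "compact (snd ` geom_points G)"
    by (intro compact_continuous_image compact_geom_points continuous_intros)+
  have *: "Inf S \<in> S" "Sup S \<in> S" if "compact S" "S \<noteq> {}" for S :: "real set"
    using that by (auto intro: closed_contains_Inf closed_contains_Sup
        simp: compact_imp_closed compact_imp_bounded bounded_imp_bdd_below bounded_imp_bdd_above)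
  show "fst (mbr_min G) \<in> fst ` geom_points G" "snd (mbr_min G) \<in> snd ` geom_points G"
      "fst (mbr_max G) \<in> fst ` geom_points G" "snd (mbr_max G) \<in> snd ` geom_points G"
    unfolding mbr_min_def mbr_max_def fst_conv snd_conv using assms by (intro *; simp add: c)+
qed

lemma "interleave (0, 1) = 2"
proof -
  have "{i. bit (0::nat) i} = {}" "{i. bit (1::nat) i} = {0}"
    by (auto simp: bit_1_iff simp del: One_nat_def)
  then show ?thesis
    by (simp only: interleave_def prod.case) simp
qed

lemma finite_digits: "finite {i. bit (n::nat) i}"
proof (rule finite_subset)
  show "{i. bit n i} \<subseteq> {..<n}"
  proof
    fix i assume "i \<in> {i. bit n i}"
    then have "2 ^ i \<le> n"
      by (metis bit_iff_odd div_less even_zero mem_Collect_eq not_le)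
    then show "i \<in> {..<n}"
      using less_exp[of i] by (simp del: less_exp)
  qed
qed simp

end

theory Submission
  imports Defs
begin

text \<open>Containment of the point sets makes the bounding rectangle of \<open>GM\<close> a subset of
  that of \<open>Q\<close>. The Z-address is monotone in both coordinates, because inserting zeros between the binary
  digits of a number is strictly monotone.\<close>

text \<open>Bit 0 is set exactly for odd \<open>n\<close>, and the remaining set bits are those of
  \<open>n div 2\<close> shifted up by one. This peels off the lowest digit for an induction by
  halving.\<close>

lemma sum_bits_rec:
  fixes f :: "nat \<Rightarrow> 'a::comm_monoid_add" and n :: nat
  shows "(\<Sum>i | bit n i. f i) = (if odd n then f 0 else 0) + (\<Sum>i | bit (n div 2) i. f (Suc i))"
proof -
  have "{i. bit n i} = (if odd n then {0} else {}) \<union> Suc ` {i. bit (n div 2) i}" (is "_ = ?A \<union> ?B")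
  proof (rule set_eqI)
    fix i show "i \<in> {i. bit n i} \<longleftrightarrow> i \<in> ?A \<union> ?B"
      by (cases i) (auto simp: bit_0 bit_Suc)
  qed
  then have "(\<Sum>i | bit n i. f i) = sum f (?A \<union> ?B)"
    by (rule arg_cong)
  also have "\<dots> = sum f ?A + sum f ?B"
    by (rule sum.union_disjoint) (auto simp: finite_digits)
  also have "sum f ?B = (\<Sum>i | bit (n div 2) i. f (Suc i))"
    by (simp add: sum.reindex)
  also have "sum f ?A = (if odd n then f 0 else 0)" by simp
  finally show ?thesis .
qed

text \<open>The binary digits of \<open>n\<close> read in base 4, so bit \<open>i\<close> moves to
  position \<open>2 * i\<close>.\<close>

definition spread_bits :: "nat \<Rightarrow> nat" where
  "spread_bits n = (\<Sum>i | bit n i. 4 ^ i)"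

lemma spread_bits_rec: "spread_bits n = n mod 2 + 4 * spread_bits (n div 2)"
proof -
  have "spread_bits n = (if odd n then 4 ^ 0 else 0) + (\<Sum>i | bit (n div 2) i. 4 ^ Suc i)"
    unfolding spread_bits_def by (rule sum_bits_rec)
  also have "(if odd n then 4 ^ 0 else 0) = n mod 2"
    by (simp add: mod2_eq_if)
  also have "(\<Sum>i | bit (n div 2) i. 4 ^ Suc i) = 4 * spread_bits (n div 2)"
    unfolding spread_bits_def sum_distrib_left power_Suc by (rule refl)
  finally show ?thesis .
qed

lemma strict_mono_spread_bits: "strict_mono spread_bits"
proof (rule strict_monoI)
  fix m n :: nat assume "m < n"
  then show "spread_bits m < spread_bits n"
  proof (induction n arbitrary: m rule: less_induct)
    case (less n)
    \<comment> \<open>Halving preserves \<le>; if the halves agree, the last bit must decide the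
      order.\<close>
    have "m div 2 < n div 2 \<or> m div 2 = n div 2 \<and> m mod 2 < n mod 2"
      using less.prems div_le_mono[of m n 2] div_mult_mod_eq[of m 2] div_mult_mod_eq[of n 2]
      by (metis add_less_cancel_left le_neq_implies_less less_imp_le)
    then have "m mod 2 + 4 * spread_bits (m div 2) < n mod 2 + 4 * spread_bits (n div 2)"
    proof (elim disjE conjE)
      assume "m div 2 < n div 2"
      moreover have "n div 2 < n"
        using less.prems by (intro div_less_dividend) auto
      ultimately have "spread_bits (m div 2) < spread_bits (n div 2)"
        by (intro less.IH)
      \<comment> \<open>A step of at least one in the higher part weighs 4, which outweighs a lowest
        digit \<open>a\<close> of at most 1.\<close>
      moreover have "a + 4 * x < b + 4 * y" if "x < y" "a < 2" for a b x y :: nat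
        using that by linarith
      ultimately show ?thesis by simp
    qed simp
    then show ?case
      by (simp only: spread_bits_rec[symmetric])
  qed
qed

text \<open>The digits of \<open>y\<close> sit one position above those of \<open>x\<close>, so the
  address is the spread of \<open>x\<close> plus twice the spread of \<open>y\<close>, each monotone
  in its own argument.\<close>

lemma interleave_mono:
  assumes "x \<le> x'" "y \<le> y'"
  shows "interleave (x, y) \<le> interleave (x', y')"
proof -
  have "interleave (a, b) = spread_bits a + 2 * spread_bits b" for a b
    by (simp add: interleave_def spread_bits_def power_mult sum_distrib_left)
  then show ?thesis
    using assms[THEN monoD[OF strict_mono_mono[OF strict_mono_spread_bits]]] by simp
qed

text \<open>Shifting, dividing by a positive \<open>c\<close>, \<open>floor\<close> and
  \<open>nat\<close> are all monotone, hence so is each grid coordinate.\<close>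

lemma z_address_mono:
  assumes "c > 0" "fst p \<le> fst q" "snd p \<le> snd q"
  shows "z_address c p \<le> z_address c q"
  unfolding z_address_def grid_coords_def using assms
  by (intro interleave_mono nat_mono floor_mono divide_right_mono) auto

lemma
  assumes "geom_points G \<subseteq> geom_points H" "geom_points G \<noteq> {}"
  shows fst_mbr_min_antimono: "fst (mbr_min H) \<le> fst (mbr_min G)"
    and snd_mbr_min_antimono: "snd (mbr_min H) \<le> snd (mbr_min G)"
    and fst_mbr_max_mono: "fst (mbr_max G) \<le> fst (mbr_max H)"
    and snd_mbr_max_mono: "snd (mbr_max G) \<le> snd (mbr_max H)"
proof -
  \<comment> \<open>On the reals, comparing \<open>Inf\<close> and \<open>Sup\<close> of nested sets
    requires bounds on the larger set; compactness supplies them.\<close>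
  have "bounded (fst ` geom_points H)" "bounded (snd ` geom_points H)"
    using compact_imp_bounded[OF compact_geom_points] bounded_fst bounded_snd by blast+
  note bdd = this[THEN bounded_imp_bdd_below] this[THEN bounded_imp_bdd_above]
  show "fst (mbr_min H) \<le> fst (mbr_min G)" "snd (mbr_min H) \<le> snd (mbr_min G)"
      "fst (mbr_max G) \<le> fst (mbr_max H)" "snd (mbr_max G) \<le> snd (mbr_max H)"
    unfolding mbr_min_def mbr_max_def fst_conv snd_conv using assms
    by (auto intro!: cInf_superset_mono cSup_subset_mono bdd image_mono)
qed

lemma
  assumes "geom_points G \<noteq> {}"
  shows fst_mbr_min_le_max: "fst (mbr_min G) \<le> fst (mbr_max G)"
    and snd_mbr_min_le_max: "snd (mbr_min G) \<le> snd (mbr_max G)"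
proof -
  have "bounded (fst ` geom_points G)" "bounded (snd ` geom_points G)"
    using compact_imp_bounded[OF compact_geom_points] bounded_fst bounded_snd by blast+
  note bdd = this[THEN bounded_imp_bdd_below] this[THEN bounded_imp_bdd_above]
  show "fst (mbr_min G) \<le> fst (mbr_max G)" "snd (mbr_min G) \<le> snd (mbr_max G)"
    unfolding mbr_min_def mbr_max_def fst_conv snd_conv using assms
    by (auto intro!: cInf_le_cSup bdd)
qed

theorem lemma1:
  fixes c :: real and Q GM :: geometry
  assumes "c > 0"
    and "valid_geometry Q" and "valid_geometry GM"
    and "contains Q GM"
  shows "Zitvl c GM \<subseteq> Zitvl c Q \<and>
         (Zmin c Q \<le> Zmin c GM \<and> Zmin c GM \<le> Zmax c Q) \<and>
         (Zmin c Q \<le> Zmax c GM \<and> Zmax c GM \<le> Zmax c Q)"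
proof -
  \<comment> \<open>The exterior is the complement of the point set, so avoiding the exterior of
    \<open>Q\<close> is inclusion in \<open>Q\<close>.\<close>
  have sub: "geom_points GM \<subseteq> geom_points Q"
    using assms(4) by (auto simp: contains_def geom_exterior_def)
  have ne: "geom_points GM \<noteq> {}"
    using assms(3) by (simp add: valid_geometry_def)
  \<comment> \<open>The first two inequalities nest the end points; the third links them, and
    transitivity gives the two remaining bounds.\<close>
  have "Zmin c Q \<le> Zmin c GM" "Zmax c GM \<le> Zmax c Q" "Zmin c GM \<le> Zmax c GM"
    unfolding Zmin_def Zmax_def using assms(1) sub ne
    by (auto intro!: z_address_mono fst_mbr_min_antimono snd_mbr_min_antimono
        fst_mbr_max_mono snd_mbr_max_mono fst_mbr_min_le_max snd_mbr_min_le_max)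
  then show ?thesis
    by (auto simp: Zitvl_def)
qed

end
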